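(* Let $f\in\mathbb{R}[x_1,\ldots,x_n]$ be a form (homogeneous polynomial) of degree $d$ and let $\mathbf{x}^*\in\mathbb{S}^{n-1}$ be a local minimizer of $f$ on $\mathbb{S}^{n-1}$. Then in the first-order condition (FONC), $\nabla f(\mathbf{x}^* )+2\lambda^*\mathbf{x}^*=0$, one has $2\lambda^*=-d\,f(\mathbf{x}^* )$. In addition, (FONC) holds if and only if $$\|\nabla f(\mathbf{x}^* )\|^2=d^2 f(\mathbf{x}^* )^2 ,$$ and the second-order condition (SONC) reads $$\mathbf{u}^T\nabla^2 f(\mathbf{x}^* )\mathbf{u}\ \ge\ d\,f(\mathbf{x}^* )\qquad\text{for all }\mathbf{u}\in(\mathbf{x}^* )^\perp .$$
   Context: $\mathbb{S}^{n-1}$ is the Euclidean unit sphere in $\mathbb{R}^n$; $(\mathbf{x}^* )^\perp:=\{\mathbf{u}\in\mathbb{S}^{n-1}:\mathbf{u}^T\mathbf{x}^*=0\}$; $\nabla f$ and $\nabla^2 f$ are the gradient and Hessian of $f$. A local minimizer of $f$ on $\mathbb{S}^{n-1}$ is a point $\mathbf{x}^*\in\mathbb{S}^{n-1}$ such that for some $\varepsilon>0$, $f(\mathbf{x}^* )\le f(\mathbf{x})$ for all $\mathbf{x}\in\mathbb{S}^{n-1}$ with $\|\mathbf{x}-\mathbf{x}^*\|<\varepsilon$. (FONC) is the condition that there exists $\lambda^*\in\mathbb{R}$ with $\nabla f(\mathbf{x}^* )+2\lambda^*\mathbf{x}^*=0$. (SONC) is the condition that, with this $\lambda^*$, $\mathbf{u}^T\nabla^2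 f(\mathbf{x}^* )\mathbf{u}+2\lambda^*\ge 0$ for all $\mathbf{u}\in(\mathbf{x}^* )^\perp$. Both are standard necessary conditions for $\mathbf{x}^*$ to be a local minimizer of $f$ on $\mathbb{S}^{n-1}$. *)

theory Defs
  imports "HOL-Analysis.Analysis" "HOL-Library.Poly_Mapping"
begin

text \<open>
  A polynomial in the variables indexed by \<open>'n\<close> is a finitely supported map from exponent
  vectors (monomials) to real coefficients, so \<open>('n \<Rightarrow>\<^sub>0 nat) \<Rightarrow>\<^sub>0 real\<close> plays the role of
  \<open>R[x_1, ..., x_n]\<close> with \<open>n = CARD('n)\<close>.
\<close>

type_synonym 'n rpoly = "('n \<Rightarrow>\<^sub>0 nat) \<Rightarrow>\<^sub>0 real"

definition peval :: "'n::finite rpoly \<Rightarrow> real ^ 'n \<Rightarrow> real" where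
  "peval p x = (\<Sum>m\<in>Poly_Mapping.keys p.
      Poly_Mapping.lookup p m * (\<Prod>i\<in>UNIV. (x $ i) ^ Poly_Mapping.lookup m i))"

text \<open>By the usual convention the zero polynomial is a form of every degree.\<close>

definition is_form :: "nat \<Rightarrow> 'n::finite rpoly \<Rightarrow> bool" where
  "is_form d p \<longleftrightarrow> (\<forall>m\<in>Poly_Mapping.keys p. (\<Sum>i\<in>UNIV. Poly_Mapping.lookup m i) = d)"

text \<open>The value is unspecified at points where \<open>f\<close> is not differentiable.\<close>

definition gradient :: "('a::real_inner \<Rightarrow> real) \<Rightarrow> 'a \<Rightarrow> 'a" where
  "gradient f x = (THE D. GDERIV f x :> D)"

lemma gradient_eqI:
  assumes "GDERIV f x :> D"
  shows "gradient f x = D"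
  unfolding gradient_def
proof (rule the_equality)
  show "GDERIV f x :> D" by (rule assms)
next
  fix E assume "GDERIV f x :> E"
  with assms have "(\<lambda>h. inner h E) = (\<lambda>h. inner h D)"
    unfolding gderiv_def by (blast intro: has_derivative_unique)
  then have "\<forall>h. inner h E = inner h D" by metis
  then show "E = D" by (metis vector_eq_ldot)
qed

text \<open>The \<open>(i, j)\<close> entry is the \<open>j\<close>-th partial derivative of the \<open>i\<close>-th component of the gradient.\<close>

definition hessian :: "(real ^ 'n \<Rightarrow> real) \<Rightarrow> real ^ 'n \<Rightarrow> real ^ 'n ^ 'n" where
  "hessian f x = jacobian (gradient f) (at x)"

definition local_minimizer_on :: "('a::real_normed_vector \<Rightarrow> real) \<Rightarrow> 'a set \<Rightarrow> 'a \<Rightarrow> bool" where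
  "local_minimizer_on f S x \<longleftrightarrow>
     x \<in> S \<and> (\<exists>\<epsilon>>0. \<forall>y\<in>S. norm (y - x) < \<epsilon> \<longrightarrow> f x \<le> f y)"

text \<open>Note that only unit vectors are taken.\<close>

definition unit_perp :: "'a::real_inner \<Rightarrow> 'a set" where
  "unit_perp x = {u \<in> sphere 0 1. inner u x = 0}"

definition is_multiplier :: "('a::real_inner \<Rightarrow> real) \<Rightarrow> 'a \<Rightarrow> real \<Rightarrow> bool" where
  "is_multiplier f x \<mu> \<longleftrightarrow> gradient f x + (2 * \<mu>) *\<^sub>R x = 0"

definition FONC :: "('a::real_inner \<Rightarrow> real) \<Rightarrow> 'a \<Rightarrow> bool" where
  "FONC f x \<longleftrightarrow> (\<exists>\<mu>. is_multiplier f x \<mu>)"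

text \<open>Meant to be used with a \<open>\<mu>\<close> for which \<open>is_multiplier f x \<mu>\<close> holds.\<close>

definition SONC :: "(real ^ 'n \<Rightarrow> real) \<Rightarrow> real ^ 'n \<Rightarrow> real \<Rightarrow> bool" where
  "SONC f x \<mu> \<longleftrightarrow> (\<forall>u\<in>unit_perp x. inner u (hessian f x *v u) + 2 * \<mu> \<ge> 0)"

end

theory Submission
  imports Defs
begin

text \<open>
  Let \<open>f\<close> be the function of the form \<open>p\<close>, with gradient \<open>G\<close>. Differentiating
  \<open>f (t x) = t ^ d * f x\<close> at \<open>t = 1\<close> gives Euler's identity \<open>x \<bullet> G x = d * f x\<close>. At a unit vector
  it says that \<open>d * f x\<close> is the radial component of the gradient. So the only candidate for the
  multiplier is \<open>2 * \<mu> = - d * f x\<close>, and by Pythagoras the first-order condition, that the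
  tangential component of \<open>G x\<close> vanishes, is the equality of \<open>norm (G x)\<^sup>2\<close> and \<open>(d * f x)\<^sup>2\<close>.

  The two necessary conditions come from the great circles \<open>c t = cos t x + sin t u\<close> with \<open>u\<close> a
  unit vector orthogonal to \<open>x\<close>. They stay on the sphere, so \<open>\<phi> t = f (c t)\<close> has a local minimum
  at \<open>0\<close>, where \<open>\<phi>' 0 = G x \<bullet> u\<close> and, because \<open>c'' 0 = - x\<close>, \<open>\<phi>'' 0 = u \<bullet> H u - G x \<bullet> x\<close>
  with \<open>H\<close> the Hessian. Now \<open>\<phi>' 0 = 0\<close> for all such \<open>u\<close> makes \<open>G x\<close> radial, and
  \<open>\<phi>'' 0 \<ge> 0\<close> is the second-order condition, in which \<open>G x \<bullet> x\<close> may be replaced by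
  \<open>d * f x\<close> or by \<open>- 2 * \<mu>\<close>.
\<close>

section \<open>Polynomials and their gradients\<close>

lemma peval_homogeneous:
  assumes "is_form d p"
  shows "peval p (t *\<^sub>R y) = t ^ d * peval p y"
proof -
  have "(\<Prod>i\<in>UNIV. ((t *\<^sub>R y) $ i) ^ Poly_Mapping.lookup m i)
      = t ^ d * (\<Prod>i\<in>UNIV. (y $ i) ^ Poly_Mapping.lookup m i)"
    if "m \<in> Poly_Mapping.keys p" for m
    using assms that
    by (auto simp: is_form_def power_mult_distrib prod.distrib power_sum[symmetric])
  then show ?thesis
    by (simp add: peval_def sum_distrib_left mult.left_commute)
qed

text \<open>
  Expanding along the standard basis, rather than giving the components, makes differentiability
  of \<open>poly_grad p\<close> follow from the rules for sums and products of real functions. For an exponent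
  \<open>0\<close> the truncated difference is harmless, as the factor in front of the power vanishes.
\<close>

definition poly_grad :: "'n::finite rpoly \<Rightarrow> real ^ 'n \<Rightarrow> real ^ 'n" where
  "poly_grad p x = (\<Sum>i\<in>UNIV. (\<Sum>m\<in>Poly_Mapping.keys p. Poly_Mapping.lookup p m *
      (real (Poly_Mapping.lookup m i) * (x $ i) ^ (Poly_Mapping.lookup m i - 1) *
       (\<Prod>j\<in>UNIV - {i}. (x $ j) ^ Poly_Mapping.lookup m j))) *\<^sub>R axis i 1)"

lemma gderiv_peval:
  fixes p :: "'n::finite rpoly"
  shows "GDERIV (peval p) x :> poly_grad p x"
proof -
  have mono: "((\<lambda>x. \<Prod>i\<in>UNIV. (x $ i) ^ Poly_Mapping.lookup m i) has_derivative
      (\<lambda>h. \<Sum>i\<in>UNIV. (real (Poly_Mapping.lookup m i) * (h $ i) *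
         (x $ i) ^ (Poly_Mapping.lookup m i - 1)) *
         (\<Prod>j\<in>UNIV - {i}. (x $ j) ^ Poly_Mapping.lookup m j))) (at x)" for m :: "'n \<Rightarrow>\<^sub>0 nat"
    by (intro has_derivative_prod)
       (auto intro!: derivative_eq_intros bounded_linear.has_derivative[OF bounded_linear_vec_nth]
         simp: fun_eq_iff ac_simps)
  have "(peval p has_derivative (\<lambda>h. \<Sum>m\<in>Poly_Mapping.keys p. Poly_Mapping.lookup p m *
      (\<Sum>i\<in>UNIV. (real (Poly_Mapping.lookup m i) * (h $ i) *
         (x $ i) ^ (Poly_Mapping.lookup m i - 1)) *
         (\<Prod>j\<in>UNIV - {i}. (x $ j) ^ Poly_Mapping.lookup m j)))) (at x)"
    unfolding peval_def[abs_def]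
    by (intro has_derivative_sum has_derivative_mult_right mono)
  moreover have "(\<lambda>h. \<Sum>m\<in>Poly_Mapping.keys p. Poly_Mapping.lookup p m *
      (\<Sum>i\<in>UNIV. (real (Poly_Mapping.lookup m i) * (h $ i) *
         (x $ i) ^ (Poly_Mapping.lookup m i - 1)) *
         (\<Prod>j\<in>UNIV - {i}. (x $ j) ^ Poly_Mapping.lookup m j)))
     = (\<lambda>h. inner h (poly_grad p x))"
    unfolding poly_grad_def inner_sum_right inner_scaleR_right inner_axis
      sum_distrib_left sum_distrib_right
    by (subst sum.swap) (simp add: ac_simps)
  ultimately show ?thesis
    by (simp add: gderiv_def)
qed

lemma gradient_peval: "gradient (peval p) = poly_grad p"
  by (rule ext) (rule gradient_eqI[OF gderiv_peval])

lemma differentiable_poly_grad: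
  fixes p :: "'n::finite rpoly"
  shows "poly_grad p differentiable (at x)"
proof -
  have nth: "(\<lambda>x. x $ i) differentiable (at x)" for i :: 'n
    by (rule bounded_linear_imp_differentiable[OF bounded_linear_vec_nth])
  have prod: "(\<lambda>x. \<Prod>j\<in>J. (x $ j) ^ k j) differentiable (at x)" for J :: "'n set" and k
    using finite[of J]
  proof (induction J rule: finite_induct)
    case (insert j J)
    then show ?case by (simp add: differentiable_mult differentiable_power nth)
  qed simp
  show ?thesis
    unfolding poly_grad_def[abs_def]
    by (intro differentiable_sum differentiable_scaleR differentiable_mult differentiable_power
        differentiable_const nth prod finite finite_keys ballI)
qed

text \<open>
  A Jacobian matrix represents the derivative only where there is one; the gradient of a
  polynomial has one everywhere.
\<close>

lemma has_derivative_gradient_peval: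
  "(gradient (peval p) has_derivative (\<lambda>h. hessian (peval p) x *v h)) (at x)"
  unfolding hessian_def gradient_peval
  using differentiable_poly_grad jacobian_works by blast

section \<open>Homogeneous functions at a unit vector\<close>

lemma gderiv_along_curve:
  fixes f :: "'a::real_inner \<Rightarrow> real"
  assumes "GDERIV f (c t) :> D" and "(c has_vector_derivative v) (at t)"
  shows "((\<lambda>t. f (c t)) has_real_derivative inner v D) (at t)"
proof -
  have "((\<lambda>t. f (c t)) has_derivative (\<lambda>s. inner (s *\<^sub>R v) D)) (at t)"
    using assms unfolding gderiv_def has_vector_derivative_def
    by (intro has_derivative_compose[of c _ t UNIV f, simplified]) auto
  then show ?thesis
    by (simp add: has_field_derivative_def mult.commute[of _ "inner v D"])
qed

text \<open>Euler's identity: both sides are derivatives of \<open>t \<mapsto> f (t x) = t ^ d * f x\<close> at \<open>1\<close>.\<close>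

lemma euler_identity:
  fixes f :: "'a::real_inner \<Rightarrow> real"
  assumes hom: "\<And>t. f (t *\<^sub>R x) = t ^ d * f x" and D: "GDERIV f x :> D"
  shows "inner x D = real d * f x"
proof (rule DERIV_unique)
  have "((\<lambda>t. t *\<^sub>R x) has_vector_derivative x) (at 1)"
    by (auto intro!: derivative_eq_intros)
  then show "((\<lambda>t. f (t *\<^sub>R x)) has_real_derivative inner x D) (at 1)"
    using D by (intro gderiv_along_curve) auto
  show "((\<lambda>t. f (t *\<^sub>R x)) has_real_derivative real d * f x) (at 1)"
    unfolding hom by (auto intro!: derivative_eq_intros)
qed

text \<open>
  Pairing the first-order condition with the unit vector \<open>x\<close> leaves a single candidate for the
  multiplier.
\<close>

lemma is_multiplier_iff:
  assumes "norm x = 1"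
  shows "is_multiplier f x \<mu> \<longleftrightarrow>
    2 * \<mu> = - inner x (gradient f x) \<and> gradient f x = inner x (gradient f x) *\<^sub>R x"
    (is "?L \<longleftrightarrow> ?R")
proof
  assume ?L
  then have G: "gradient f x = (- (2 * \<mu>)) *\<^sub>R x"
    by (simp add: is_multiplier_def eq_neg_iff_add_eq_0)
  then have "inner x (gradient f x) = - (2 * \<mu>)"
    using assms by (simp add: dot_square_norm)
  then show ?R using G by simp
next
  assume R: ?R
  then have "gradient f x = (- (2 * \<mu>)) *\<^sub>R x" by simp
  then show ?L by (simp add: is_multiplier_def)
qed

lemma FONC_iff_radial:
  assumes "norm x = 1"
  shows "FONC f x \<longleftrightarrow> gradient f x = inner x (gradient f x) *\<^sub>R x"
  unfolding FONC_def is_multiplier_iff[OF assms]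
  by (auto intro: exI[of _ "- inner x (gradient f x) / 2"])

text \<open>
  By Pythagoras, a vector is as long as its component along \<open>x\<close> exactly if it has no component
  orthogonal to \<open>x\<close>.
\<close>

lemma radial_iff_norm:
  fixes x v :: "'a::real_inner"
  assumes "norm x = 1"
  shows "v = inner x v *\<^sub>R x \<longleftrightarrow> (norm v)\<^sup>2 = (inner x v)\<^sup>2"
proof -
  have "inner x x = 1"
    using assms by (simp add: dot_square_norm)
  then have "(norm (v - inner x v *\<^sub>R x))\<^sup>2 = (norm v)\<^sup>2 - (inner x v)\<^sup>2"
    unfolding power2_norm_eq_inner
    by (simp add: inner_diff_left inner_diff_right inner_commute[of v x] power2_eq_square)
  then show ?thesis
    by (metis eq_iff_diff_eq_0 norm_eq_zero zero_eq_power2)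
qed

section \<open>Minima along great circles\<close>

text \<open>
  If the second derivative were negative, the first derivative would be negative just to the right
  of the critical point, and the function would fall below its minimum there.
\<close>

lemma second_derivative_nonneg_at_local_min:
  fixes g :: "real \<Rightarrow> real"
  assumes g: "\<And>t. (g has_real_derivative g' t) (at t)"
    and g': "(g' has_real_derivative D) (at a)" and crit: "g' a = 0"
    and \<delta>: "\<delta> > 0" and min: "\<And>t. \<bar>t - a\<bar> < \<delta> \<Longrightarrow> g a \<le> g t"
  shows "0 \<le> D"
proof (rule ccontr)
  assume "\<not> 0 \<le> D"
  then obtain e where "e > 0" and e: "\<And>h. 0 < h \<Longrightarrow> h < e \<Longrightarrow> g' (a + h) < 0"
    using DERIV_neg_dec_right[OF g'] crit by auto
  define h where "h = min e \<delta> / 2"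
  have h: "0 < h" "h < e" "h < \<delta>"
    using \<open>e > 0\<close> \<delta> by (auto simp: h_def)
  obtain z where z: "a < z" "z < a + h" "g (a + h) - g a = (a + h - a) * g' z"
    using MVT2[of a "a + h" g g'] g h by auto
  have "g' z < 0"
    using e[of "z - a"] z h by simp
  then have "g (a + h) < g a"
    using z h mult_pos_neg[of h "g' z"] by simp
  moreover have "g a \<le> g (a + h)"
    using min h by simp
  ultimately show False by simp
qed

definition great_circle :: "'a::real_vector \<Rightarrow> 'a \<Rightarrow> real \<Rightarrow> 'a" where
  "great_circle x u t = cos t *\<^sub>R x + sin t *\<^sub>R u"

lemma great_circle_0 [simp]: "great_circle x u 0 = x"
  by (simp add: great_circle_def)

lemma great_circle_in_sphere:
  assumes "norm x = 1" and "u \<in> unit_perp x"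
  shows "great_circle x u t \<in> sphere 0 1"
proof -
  have "inner u u = 1" "inner x x = 1" "inner u x = 0" "inner x u = 0"
    using assms by (auto simp: unit_perp_def dot_square_norm inner_commute)
  then have "(norm (great_circle x u t))\<^sup>2 = (cos t)\<^sup>2 + (sin t)\<^sup>2"
    unfolding power2_norm_eq_inner great_circle_def
    by (simp add: inner_add_left inner_add_right power2_eq_square)
  then show ?thesis
    by (simp add: power2_eq_1_iff) (metis norm_ge_zero not_one_le_zero neg_0_le_iff_le)
qed

text \<open>
  A quarter turn takes position to velocity, so the velocity runs through the same circle and can
  be differentiated by the same rule.
\<close>

lemma great_circle_has_vector_derivative:
  "(great_circle x u has_vector_derivative great_circle u (- x) t) (at t)"
  unfolding great_circle_def[abs_def]
  by (auto intro!: derivative_eq_intros simp: has_real_derivative_iff_has_vector_derivative)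

lemma local_min_along_great_circle:
  assumes min: "local_minimizer_on f (sphere 0 1) x" and u: "u \<in> unit_perp x"
  obtains \<delta> where "\<delta> > 0" "\<And>t. \<bar>t\<bar> < \<delta> \<Longrightarrow> f x \<le> f (great_circle x u t)"
proof -
  obtain \<epsilon> where "\<epsilon> > 0"
    and \<epsilon>: "\<And>y. y \<in> sphere 0 1 \<Longrightarrow> norm (y - x) < \<epsilon> \<Longrightarrow> f x \<le> f y"
    using min by (auto simp: local_minimizer_on_def)
  have x: "norm x = 1"
    using min by (simp add: local_minimizer_on_def)
  have "continuous (at 0) (great_circle x u)"
    by (rule has_vector_derivative_continuous[OF great_circle_has_vector_derivative])
  then obtain \<delta> where "\<delta> > 0" "\<And>t. \<bar>t\<bar> < \<delta> \<Longrightarrow> norm (great_circle x u t - x) < \<epsilon>"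
    using \<open>\<epsilon> > 0\<close> unfolding continuous_at_eps_delta by (auto simp: dist_norm)
  with that \<epsilon> great_circle_in_sphere[OF x u] show thesis
    by blast
qed

lemma first_order_along_great_circle:
  fixes f :: "'a::real_inner \<Rightarrow> real"
  assumes min: "local_minimizer_on f (sphere 0 1) x" and u: "u \<in> unit_perp x"
    and D: "GDERIV f x :> D"
  shows "inner u D = 0"
proof -
  obtain \<delta> where "\<delta> > 0" and \<delta>: "\<And>t. \<bar>t\<bar> < \<delta> \<Longrightarrow> f x \<le> f (great_circle x u t)"
    using local_min_along_great_circle[OF min u] by blast
  have "((\<lambda>t. f (great_circle x u t)) has_real_derivative inner (great_circle u (- x) 0) D) (at 0)"
    using D by (intro gderiv_along_curve great_circle_has_vector_derivative) simp
  then show ?thesis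
    using DERIV_local_min[of _ _ 0 \<delta>] \<open>\<delta> > 0\<close> \<delta> by fastforce
qed

text \<open>
  The term \<open>- inner x (G x)\<close> comes from the curvature of the sphere: the acceleration of the great
  circle at \<open>x\<close> is \<open>- x\<close>.
\<close>

lemma second_order_along_great_circle:
  fixes f :: "'a::real_inner \<Rightarrow> real"
  assumes min: "local_minimizer_on f (sphere 0 1) x" and u: "u \<in> unit_perp x"
    and G: "\<And>y. GDERIV f y :> G y" and H: "(G has_derivative H) (at x)"
  shows "0 \<le> inner u (H u) - inner x (G x)"
proof -
  obtain \<delta> where \<delta>: "\<delta> > 0" "\<And>t. \<bar>t\<bar> < \<delta> \<Longrightarrow> f x \<le> f (great_circle x u t)"
    using local_min_along_great_circle[OF min u] by blast
  define g' where "g' t = inner (great_circle u (- x) t) (G (great_circle x u t))" for t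
  have g: "((\<lambda>t. f (great_circle x u t)) has_real_derivative g' t) (at t)" for t
    unfolding g'_def by (intro gderiv_along_curve great_circle_has_vector_derivative G)
  have "((\<lambda>t. G (great_circle x u t)) has_derivative (\<lambda>s. H (s *\<^sub>R u))) (at 0)"
    using has_derivative_compose[of "great_circle x u" "\<lambda>s. s *\<^sub>R u" 0 UNIV G H] H
      great_circle_has_vector_derivative[of x u 0]
    by (simp add: has_vector_derivative_def)
  moreover have "(great_circle u (- x) has_derivative (\<lambda>s. s *\<^sub>R (- x))) (at 0)"
    using great_circle_has_vector_derivative[of u "- x" 0]
    by (simp add: has_vector_derivative_def)
  ultimately have "(g' has_derivative
      (\<lambda>s. inner u (H (s *\<^sub>R u)) + inner (s *\<^sub>R (- x)) (G x))) (at 0)"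
    unfolding g'_def[abs_def] using has_derivative_inner by fastforce
  moreover have "H (s *\<^sub>R u) = s *\<^sub>R H u" for s
    by (rule linear_scale[OF has_derivative_linear[OF H]])
  ultimately have "(g' has_real_derivative (inner u (H u) - inner x (G x))) (at 0)"
    by (elim has_derivative_imp_has_field_derivative) (simp add: algebra_simps)
  moreover have "g' 0 = 0"
    using first_order_along_great_circle[OF min u G] by (simp add: g'_def)
  ultimately show ?thesis
    using second_derivative_nonneg_at_local_min[OF g, of "inner u (H u) - inner x (G x)" 0 \<delta>] \<delta>
    by simp
qed

text \<open>
  The normalized tangential component of the gradient is itself an admissible direction, along
  which the derivative is the length of that component.
\<close>

lemma gradient_radial_at_local_min:
  fixes f :: "'a::real_inner \<Rightarrow> real"
  assumes min: "local_minimizer_on f (sphere 0 1) x" and D: "GDERIV f x :> D"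
  shows "D = inner x D *\<^sub>R x"
proof (rule ccontr)
  define w where "w = D - inner x D *\<^sub>R x"
  assume "D \<noteq> inner x D *\<^sub>R x"
  then have w: "norm w > 0" by (simp add: w_def)
  have "norm x = 1"
    using min by (simp add: local_minimizer_on_def)
  then have wx: "inner w x = 0"
    by (simp add: w_def inner_diff_left dot_square_norm inner_commute[of D x])
  then have "w /\<^sub>R norm w \<in> unit_perp x"
    using w by (simp add: unit_perp_def)
  then have "inner (w /\<^sub>R norm w) D = 0"
    using first_order_along_great_circle[OF min _ D] by blast
  then have "inner w D = 0"
    using w by simp
  moreover have "inner w D = inner w w"
    using wx by (simp add: w_def inner_diff_right[of _ D] inner_diff_right)
  ultimately show False
    using w by simp
qed

section \<open>Optimality conditions for forms on the sphere\<close>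

theorem corollary2p2:
  fixes p :: "'n::finite rpoly" and d :: nat and x :: "real ^ 'n"
  assumes "is_form d p"
    and "local_minimizer_on (peval p) (sphere 0 1) x"
  shows "FONC (peval p) x \<and>
    (\<forall>\<mu>. is_multiplier (peval p) x \<mu> \<longrightarrow>
        2 * \<mu> = - (real d * peval p x)) \<and>
    (FONC (peval p) x \<longleftrightarrow>
        (norm (gradient (peval p) x))\<^sup>2 = (real d)\<^sup>2 * (peval p x)\<^sup>2) \<and>
    (\<forall>\<mu>. is_multiplier (peval p) x \<mu> \<longrightarrow>
        SONC (peval p) x \<mu> \<and>
        (SONC (peval p) x \<mu> \<longleftrightarrow>
          (\<forall>u\<in>unit_perp x. inner u (hessian (peval p) x *v u) \<ge> real d * peval p x)))"
proof -
  have x: "norm x = 1"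
    using assms(2) by (simp add: local_minimizer_on_def)
  have G: "GDERIV (peval p) y :> gradient (peval p) y" for y
    by (simp add: gradient_peval gderiv_peval)
  have euler: "inner x (gradient (peval p) x) = real d * peval p x"
    by (rule euler_identity[OF peval_homogeneous[OF assms(1)] G])
  have fonc: "FONC (peval p) x"
    using gradient_radial_at_local_min[OF assms(2) G] by (simp add: FONC_iff_radial[OF x])
  have mult: "2 * \<mu> = - (real d * peval p x)" if "is_multiplier (peval p) x \<mu>" for \<mu>
    using that by (simp add: is_multiplier_iff[OF x] euler)
  have norm_iff: "FONC (peval p) x \<longleftrightarrow>
      (norm (gradient (peval p) x))\<^sup>2 = (real d)\<^sup>2 * (peval p x)\<^sup>2"
    using radial_iff_norm[OF x, of "gradient (peval p) x"]
    by (simp add: FONC_iff_radial[OF x] euler power_mult_distrib)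
  have second: "inner u (hessian (peval p) x *v u) \<ge> real d * peval p x" if "u \<in> unit_perp x" for u
    using second_order_along_great_circle[OF assms(2) that G has_derivative_gradient_peval]
    by (simp add: euler)
  have sonc_iff: "SONC (peval p) x \<mu> \<longleftrightarrow>
      (\<forall>u\<in>unit_perp x. inner u (hessian (peval p) x *v u) \<ge> real d * peval p x)"
    if "is_multiplier (peval p) x \<mu>" for \<mu>
    using mult[OF that] by (simp add: SONC_def)
  show ?thesis
    using fonc mult norm_iff second sonc_iff by blast
qed

end
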